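(* Consider the system of $N$ pulse-coupled oscillators with delayed excitatory coupling described in the context, with $0<\tau<1$, $0<\varepsilon<1$ and $f(\tau)+\varepsilon<1$. Let $i\neq j$ be oscillators satisfying $\varepsilon_{ij}=\varepsilon_{ji}$ and $\varepsilon_{ki}=\varepsilon_{kj}$ for all $k\in\{1,2,\dots,N\}\setminus\{i,j\}$. Then for any solution of the system and any integers $m_i,m_j\ge 1$: if $t^i_{m_i}=t^j_{m_j}$, then $\phi_i(t)=\phi_j(t)$ for all $t\ge t^i_{m_i}$.
   Context: The system: $N$ identical oscillators $i=1,\dots,N$ have phases $\phi_i(t)\in[0,1]$, $t\ge 0$. $\mathrm{Pre}(i)$ is the set of oscillators sending pulses to $i$, and $\mathrm{Post}(i)$ is the set of oscillators receiving pulses from $i$ (so $j\in\mathrm{Post}(i)$ iff $i\in\mathrm{Pre}(j)$). The function $f:[0,1]\to[0,1]$ is twice continuously differentiable with $f'>0$, $f''<0$, $f(0)=0$, $f(1)=1$. Dynamics: (1) In the absence of interaction, $\mathrm{d}\phi_i/\mathrm{d}t=1$. (2) When $\phi_i(t)=1$, oscillator $i$ fires at time $t$ and its phase is reset instantly: $\phi_i(t^+)=0$. (3) If oscillator $i$ fires at time $t$, it emits a spike, which reaches every $j\in\mathrm{Post}(i)$ at time $t+\tau$ and induces the phase jump $\phi_j(t+\tau)=f^{-1}(\min[1,f(\phi_j((t+\tau)^-))+\varepsilon_{ij}])$, where $\varepsilon_{ij}>0$ is the coupling strength from $i$ to $j$. If several spikes reach $j$ at the same time, their strengths are added in this formula.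 (A phase brought to $1$ by a jump at time $s$ means that the oscillator fires at time $s$.) Convention: $\varepsilon_{ij}=0$ if $j\notin\mathrm{Post}(i)$. Standing assumptions: the system starts at time $t=0$ with initial phases $0<\phi_i(0)\le 1$, and no spikes emitted before time $0$ are present; there is no self-interaction, i.e. $i\notin\mathrm{Pre}(i)$; $0<\tau<1$; and for all $i$, $\sum_{j\in\mathrm{Pre}(i)}\varepsilon_{ji}=\varepsilon$ with $0<\varepsilon<1$. $t^i_m$ denotes the time at which oscillator $i$ fires for the $m$-th time ($m\ge1$). *)

theory Defs
  imports Complex_Main
begin

definition rise_function :: "(real \<Rightarrow> real) \<Rightarrow> bool" where
  "rise_function f \<longleftrightarrow>
     f ` {0..1} \<subseteq> {0..1} \<and> f 0 = 0 \<and> f 1 = 1 \<and>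
     (\<exists>f' f''. continuous_on {0..1} f'' \<and>
        (\<forall>x\<in>{0..1}.
           (f has_real_derivative f' x) (at x within {0..1}) \<and>
           (f' has_real_derivative f'' x) (at x within {0..1}) \<and>
           f' x > 0 \<and> f'' x < 0))"

definition Post :: "nat \<Rightarrow> (nat \<Rightarrow> nat set) \<Rightarrow> nat \<Rightarrow> nat set" where
  "Post N Pre i = {j \<in> {1..N}. i \<in> Pre j}"

(* eps i j is the coupling strength from i to j; etot is the common total input strength. *)
definition pulse_network ::
  "nat \<Rightarrow> (nat \<Rightarrow> nat set) \<Rightarrow> (nat \<Rightarrow> nat \<Rightarrow> real) \<Rightarrow> real \<Rightarrow> bool" where
  "pulse_network N Pre eps etot \<longleftrightarrow>
     (\<forall>i\<in>{1..N}. Pre i \<subseteq> {1..N} \<and> i \<notin> Pre i \<and> (\<Sum>j\<in>Pre i. eps j i) = etot) \<and>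
     (\<forall>i\<in>{1..N}. \<forall>j\<in>{1..N}.
        (j \<in> Post N Pre i \<longrightarrow> eps i j > 0) \<and> (j \<notin> Post N Pre i \<longrightarrow> eps i j = 0))"

(* The value of the phase at a firing time is 1; the reset concerns only its right limit. *)
definition fires :: "(nat \<Rightarrow> real \<Rightarrow> real) \<Rightarrow> nat \<Rightarrow> real \<Rightarrow> bool" where
  "fires \<phi> i t \<longleftrightarrow> t \<ge> 0 \<and> \<phi> i t = 1"

(* Oscillators whose spikes reach i at time t. As firing times are nonnegative, there are no
   spikes emitted before time 0. *)
definition senders ::
  "(nat \<Rightarrow> nat set) \<Rightarrow> real \<Rightarrow> (nat \<Rightarrow> real \<Rightarrow> real) \<Rightarrow> nat \<Rightarrow> real \<Rightarrow> nat set" where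
  "senders Pre \<tau> \<phi> i t = {k \<in> Pre i. fires \<phi> k (t - \<tau>)}"

(* The equation d phi / dt = 1 is split into one-sided derivatives: a firing at t breaks it only
   to the right of t, an incoming spike at t only to the left of t (the value at t is the one
   after the jump). Where neither happens, the two-sided derivative is 1. *)
definition solution ::
  "nat \<Rightarrow> (nat \<Rightarrow> nat set) \<Rightarrow> (nat \<Rightarrow> nat \<Rightarrow> real) \<Rightarrow> real \<Rightarrow> (real \<Rightarrow> real)
     \<Rightarrow> (nat \<Rightarrow> real \<Rightarrow> real) \<Rightarrow> bool" where
  "solution N Pre eps \<tau> f \<phi> \<longleftrightarrow> (\<forall>i\<in>{1..N}.
     0 < \<phi> i 0 \<and>
     (\<forall>t\<ge>0. 0 \<le> \<phi> i t \<and> \<phi> i t \<le> 1) \<and>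
     (\<forall>t\<ge>0. \<not> fires \<phi> i t \<longrightarrow> (\<phi> i has_real_derivative 1) (at_right t)) \<and>
     (\<forall>t>0. senders Pre \<tau> \<phi> i t = {} \<longrightarrow> (\<phi> i has_real_derivative 1) (at_left t)) \<and>
     (\<forall>t. fires \<phi> i t \<longrightarrow> (\<phi> i \<longlongrightarrow> 0) (at_right t)) \<and>
     (\<forall>t>0. senders Pre \<tau> \<phi> i t \<noteq> {} \<longrightarrow>
        (\<exists>l. (\<phi> i \<longlongrightarrow> l) (at_left t) \<and>
             \<phi> i t = the_inv_into {0..1} f
                       (min 1 (f l + (\<Sum>k\<in>senders Pre \<tau> \<phi> i t. eps k i))))))"

(* Meant for m >= 1, where the cardinality condition includes finiteness. For a solution, the
   firings of an oscillator are locally finite in time and never cease, so the time exists. *)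
definition firing_time :: "(nat \<Rightarrow> real \<Rightarrow> real) \<Rightarrow> nat \<Rightarrow> nat \<Rightarrow> real" where
  "firing_time \<phi> i m = (THE t. fires \<phi> i t \<and> card {s. fires \<phi> i s \<and> s \<le> t} = m)"

end

(* No oscillator fires twice within tau. So when i and j fire together at T, neither of them has
   fired in [T - tau, T), and every spike that i and j exchange after T was emitted at T or later.
   As long as the two phases agree from T on, these spikes are emitted simultaneously, and the
   symmetry of the couplings gives i and j equal inputs, which keeps the phases equal.
   Induction over the firings and spike arrivals is possible because firings cannot accumulate:
   the phase has one-sided limits everywhere, and the limit just after a firing is 0. *)
theory Submission
  imports Defs "HOL-Analysis.Elementary_Topology"
begin

section \<open>Monotonicity, range and concavity of the rise function\<close>

lemma rise_function_strict_mono: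
  assumes "rise_function f"
  shows "strict_mono_on {0..1} f"
proof (rule strict_mono_onI)
  obtain f' where f': "\<And>x. x \<in> {0..1} \<Longrightarrow> (f has_real_derivative f' x) (at x within {0..1})"
      "\<And>x. x \<in> {0..1} \<Longrightarrow> f' x > 0"
    using assms unfolding rise_function_def by blast
  fix x y :: real assume xy: "x \<in> {0..1}" "y \<in> {0..1}" "x < y"
  show "f x < f y"
  proof (rule DERIV_pos_imp_increasing_open[OF \<open>x < y\<close>])
    fix z assume z: "x < z" "z < y"
    then have "(f has_real_derivative f' z) (at z)"
      using f'(1)[of z] xy at_within_Icc_at[of 0 z 1] by auto
    then show "\<exists>d. (f has_real_derivative d) (at z) \<and> d > 0"
      using f'(2)[of z] z xy by auto
  next
    have "continuous_on {0..1} f" using f'(1) by (rule DERIV_continuous_on)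
    then show "continuous_on {x..y} f" by (rule continuous_on_subset) (use xy in auto)
  qed
qed

lemma rise_function_image:
  assumes "rise_function f"
  shows "f ` {0..1} = {0..1}"
proof
  show "f ` {0..1} \<subseteq> {0..1}" using assms by (simp add: rise_function_def)
  obtain f' where "\<And>x. x \<in> {0..1} \<Longrightarrow> (f has_real_derivative f' x) (at x within {0..1})"
    using assms unfolding rise_function_def by blast
  then have cont: "continuous_on {0..1} f" by (rule DERIV_continuous_on)
  show "{0..1} \<subseteq> f ` {0..1}"
  proof
    fix y :: real assume "y \<in> {0..1}"
    then obtain x where "0 \<le> x" "x \<le> 1" "f x = y"
      using IVT'[of f 0 y 1] cont assms by (auto simp: rise_function_def)
    then show "y \<in> f ` {0..1}" by auto
  qed
qed

text \<open>This is concavity in difference form: \<open>f'\<close> decreases, so the derivative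
  \<open>f' (z + h) - f' z\<close> of the increment is nonpositive. It later compares a phase
  advanced by spikes with one that runs freely.\<close>

lemma rise_function_increment_antimono:
  assumes "rise_function f" and "0 \<le> x" "x \<le> y" "0 \<le> h" "y + h \<le> 1"
  shows "f (y + h) - f y \<le> f (x + h) - f x"
proof -
  obtain f' f'' where f':
      "\<And>x. x \<in> {0..1} \<Longrightarrow> (f has_real_derivative f' x) (at x within {0..1})"
      "\<And>x. x \<in> {0..1} \<Longrightarrow> (f' has_real_derivative f'' x) (at x within {0..1})"
      "\<And>x. x \<in> {0..1} \<Longrightarrow> f'' x < 0"
    using assms(1) unfolding rise_function_def by blast
  have cont: "continuous_on {0..1} f" "continuous_on {0..1} f'"
    using DERIV_continuous_on[of "{0..1}"] f'(1,2) by blast+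
  have der: "(f has_real_derivative f' z) (at z)" "(f' has_real_derivative f'' z) (at z)"
    if "0 < z" "z < 1" for z
    using that f'(1,2)[of z] at_within_Icc_at[of 0 z 1] by auto
  have f'_anti: "f' v \<le> f' u" if "0 \<le> u" "u \<le> v" "v \<le> 1" for u v
  proof (rule DERIV_nonpos_imp_decreasing_open[OF \<open>u \<le> v\<close>])
    fix z assume "u < z" "z < v"
    then show "\<exists>d. (f' has_real_derivative d) (at z) \<and> d \<le> 0"
      using der(2)[of z] f'(3)[of z] that by (intro exI[of _ "f'' z"]) auto
  next
    show "continuous_on {u..v} f'"
      using cont(2) by (rule continuous_on_subset) (use that in auto)
  qed
  show ?thesis
  proof (rule DERIV_nonpos_imp_decreasing_open[OF \<open>x \<le> y\<close>])
    fix z assume z: "x < z" "z < y"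
    have "((\<lambda>z. f (z + h) - f z) has_real_derivative f' (z + h) - f' z) (at z)"
      using der(1)[of "z + h"] der(1)[of z] z assms
      by (intro DERIV_diff) (auto simp: DERIV_shift)
    moreover have "f' (z + h) - f' z \<le> 0"
      using f'_anti[of z "z + h"] z assms by auto
    ultimately show "\<exists>d. ((\<lambda>z. f (z + h) - f z) has_real_derivative d) (at z) \<and> d \<le> 0"
      by blast
  next
    show "continuous_on {x..y} (\<lambda>z. f (z + h) - f z)"
      by (intro continuous_on_diff continuous_on_compose2[OF cont(1)] continuous_intros)
        (use assms in auto)
  qed
qed

section \<open>Induction and enumeration along locally finite sets of times\<close>

text \<open>Induction on the number of events in \<open>{T..<t}\<close>. The step may use
  \<open>P\<close> on all of \<open>{T..a}\<close>, not only at \<open>a\<close>, because a delayed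
  system refers back to earlier times.\<close>

lemma locally_finite_event_induct [consumes 2, case_names base step]:
  fixes E :: "real set" and T t :: real
  assumes "T \<le> t" and fin: "\<And>t. finite (E \<inter> {T..t})" and "P T"
    and step: "\<And>a b. \<lbrakk>T \<le> a; a < b; E \<inter> {a<..<b} = {}; \<And>s. \<lbrakk>T \<le> s; s \<le> a\<rbrakk> \<Longrightarrow> P s\<rbrakk> \<Longrightarrow> P b"
  shows "P t"
  using \<open>T \<le> t\<close>
proof (induction "card (E \<inter> {T..<t})" arbitrary: t rule: less_induct)
  case (less b)
  have finb: "finite (E \<inter> {T..<b})"
    by (rule finite_subset[OF _ fin[of b]]) auto
  show ?case
  proof (cases "b = T")
    case True
    then show ?thesis using \<open>P T\<close> by simp
  next
    case False
    \<comment> \<open>\<open>a\<close> is the last event before \<open>b\<close>; inserting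
      \<open>T\<close> provides a value when there is none.\<close>
    let ?A = "insert T (E \<inter> {T..<b})"
    define a where "a = Max ?A"
    have A: "finite ?A" "?A \<noteq> {}" using finb by auto
    then have a: "a \<in> ?A" unfolding a_def by (rule Max_in)
    have a_max: "x \<le> a" if "x \<in> ?A" for x using A that by (simp add: a_def)
    show ?thesis
    proof (rule step)
      show "T \<le> a" "a < b" using a False less.prems by auto
      show "E \<inter> {a<..<b} = {}" using a_max \<open>T \<le> a\<close> by fastforce
      show "P s" if s: "T \<le> s" "s \<le> a" for s
      proof (cases "s = T")
        case True
        then show ?thesis using \<open>P T\<close> by simp
      next
        case False
        \<comment> \<open>Here \<open>a\<close> is a genuine event, counted for \<open>b\<close> but
          not for any \<open>s \<le> a\<close>, so the measure drops.\<close>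
        then have "a \<in> E \<inter> {T..<b}" using s a by auto
        moreover have "a \<notin> E \<inter> {T..<s}" "E \<inter> {T..<s} \<subseteq> E \<inter> {T..<b}"
          using s \<open>a < b\<close> by auto
        ultimately have "E \<inter> {T..<s} \<subset> E \<inter> {T..<b}" by blast
        then show ?thesis using less.hyps s(1) finb by (simp add: psubset_card_mono)
      qed
    qed
  qed
qed

text \<open>The counting function of \<open>F\<close> grows by exactly one from an element to the
  next, so each positive value is attained at exactly one element. This makes the \<open>THE\<close>
  in \<open>firing_time\<close> meaningful.\<close>

lemma discrete_unbounded_enumerate:
  fixes F :: "real set"
  assumes fin: "\<And>t. finite {s \<in> F. s \<le> t}" and unb: "\<And>t. \<exists>s\<in>F. t < s" and "m \<ge> 1"
  shows "\<exists>!t. t \<in> F \<and> card {s \<in> F. s \<le> t} = m"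
proof (rule ex_ex1I)
  have next_elem: "\<exists>s\<in>F. {r \<in> F. r \<le> s} = insert s {r \<in> F. r \<le> t} \<and> t < s" for t
  proof -
    obtain u where u: "u \<in> F" "t < u" using unb by blast
    let ?A = "{r \<in> F. r \<le> u \<and> t < r}"
    have A: "finite ?A" "?A \<noteq> {}"
      using finite_subset[OF _ fin[of u], of ?A] u by auto
    have min: "Min ?A \<in> ?A" using A by (rule Min_in)
    have least: "Min ?A \<le> r" if "r \<in> F" "t < r" for r
      using that A min by (cases "r \<le> u") auto
    show ?thesis
      by (rule bexI[of _ "Min ?A"]) (use min least in force)+
  qed
  have "\<exists>t\<in>F. card {s \<in> F. s \<le> t} = Suc n" for n
  proof (induction n)
    case 0
    show ?case
    proof (cases "F = {}")
      case True
      then show ?thesis using unb by blast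
    next
      case False
      then obtain u where u: "u \<in> F" by blast
      let ?A = "{s \<in> F. s \<le> u}"
      have min: "Min ?A \<in> ?A" using fin u by (intro Min_in) auto
      have "Min ?A \<le> r" if "r \<in> F" for r
        using that fin[of u] min by (cases "r \<le> u") auto
      then have "{s \<in> F. s \<le> Min ?A} = {Min ?A}" using min by force
      then show ?thesis using min by (intro bexI[of _ "Min ?A"]) auto
    qed
  next
    case (Suc n)
    then obtain t where t: "card {s \<in> F. s \<le> t} = Suc n" by blast
    obtain s where s: "s \<in> F" "{r \<in> F. r \<le> s} = insert s {r \<in> F. r \<le> t}" "t < s"
      using next_elem by blast
    then have "card {r \<in> F. r \<le> s} = Suc (Suc n)" using t fin[of t] by auto
    then show ?case using s(1) by blast
  qed
  from this[of "m - 1"] show "\<exists>t. t \<in> F \<and> card {s \<in> F. s \<le> t} = m"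
    using \<open>m \<ge> 1\<close> by auto
next
  have mono: "card {s \<in> F. s \<le> t} < card {s \<in> F. s \<le> u}" if "u \<in> F" "t < u" for t u
    by (rule psubset_card_mono[OF fin]) (use that in force)
  fix t u
  assume "t \<in> F \<and> card {s \<in> F. s \<le> t} = m" "u \<in> F \<and> card {s \<in> F. s \<le> u} = m"
  then show "t = u" using mono[of u t] mono[of t u] by (cases t u rule: linorder_cases) auto
qed

section \<open>A fixed solution: inputs and one-sided limits of the phases\<close>

locale oscillator_network =
  fixes N :: nat and Pre :: "nat \<Rightarrow> nat set" and eps :: "nat \<Rightarrow> nat \<Rightarrow> real"
    and etot \<tau> :: real and f :: "real \<Rightarrow> real" and \<phi> :: "nat \<Rightarrow> real \<Rightarrow> real"
  assumes rise: "rise_function f"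
    and network: "pulse_network N Pre eps etot"
    and delay: "0 < \<tau>" "\<tau> < 1"
    and weak: "f \<tau> + etot < 1"
    and sol: "solution N Pre eps \<tau> f \<phi>"
begin

text \<open>Summing over all oscillators, with zero couplings outside \<open>Pre i\<close>, lets the
  inputs of two oscillators be compared term by term.\<close>

definition input :: "nat \<Rightarrow> real \<Rightarrow> real" where
  "input i t = (\<Sum>k\<in>{1..N}. if fires \<phi> k (t - \<tau>) then eps k i else 0)"

text \<open>The right limit of the phase, from which the free motion after \<open>t\<close>
  starts.\<close>

definition phase_after :: "nat \<Rightarrow> real \<Rightarrow> real" where
  "phase_after i t = (if \<phi> i t = 1 then 0 else \<phi> i t)"

text \<open>Firings and arrival times of all oscillators together, so that one subdivision of time
  serves every phase.\<close>

definition events :: "real set" where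
  "events = {t. \<exists>k\<in>{1..N}. fires \<phi> k t \<or> fires \<phi> k (t - \<tau>)}"

lemma phase_range: "0 \<le> \<phi> i t" "\<phi> i t \<le> 1" if "i \<in> {1..N}" "0 \<le> t"
  using sol that by (auto simp: solution_def)

lemma phase_after_range: "0 \<le> phase_after i t" "phase_after i t \<le> 1" if "i \<in> {1..N}" "0 \<le> t"
  using phase_range[OF that] by (auto simp: phase_after_def)

lemma f_range: "0 \<le> f x" "f x \<le> 1" if "0 \<le> x" "x \<le> 1"
  using rise_function_image[OF rise] that by auto

lemma f_le_iff: "f x \<le> f y \<longleftrightarrow> x \<le> y" if "x \<in> {0..1}" "y \<in> {0..1}"
  using strict_mono_on_less_eq[OF rise_function_strict_mono[OF rise] that] .

lemma f_inj: "inj_on f {0..1}"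
  using rise_function_strict_mono[OF rise] by (rule strict_mono_on_imp_inj_on)

lemma eps_nonneg: "0 \<le> eps k i" if "k \<in> {1..N}" "i \<in> {1..N}"
  using network that by (cases "i \<in> Post N Pre k") (fastforce simp: pulse_network_def)+

lemma eps_eq_0: "eps k i = 0" if "k \<in> {1..N}" "i \<in> {1..N}" "k \<notin> Pre i"
  using network that by (auto simp: pulse_network_def Post_def)

lemma Pre_subset: "Pre i \<subseteq> {1..N}" if "i \<in> {1..N}"
  using network that by (auto simp: pulse_network_def)

lemma eps_self: "eps i i = 0" if "i \<in> {1..N}"
  using network that by (intro eps_eq_0) (auto simp: pulse_network_def)

lemma sum_eps: "(\<Sum>k\<in>{1..N}. eps k i) = etot" if "i \<in> {1..N}"
proof -
  have "(\<Sum>k\<in>Pre i. eps k i) = (\<Sum>k\<in>{1..N}. eps k i)"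
    using Pre_subset[OF that] eps_eq_0 that by (intro sum.mono_neutral_left) auto
  then show ?thesis using network that by (auto simp: pulse_network_def)
qed

lemma input_nonneg: "0 \<le> input i t" if "i \<in> {1..N}"
  unfolding input_def using eps_nonneg that by (intro sum_nonneg) auto

lemma sum_senders_eq_input:
  assumes "i \<in> {1..N}"
  shows "(\<Sum>k\<in>senders Pre \<tau> \<phi> i t. eps k i) = input i t"
proof -
  have "(\<Sum>k\<in>senders Pre \<tau> \<phi> i t. eps k i)
      = (\<Sum>k\<in>senders Pre \<tau> \<phi> i t. if fires \<phi> k (t - \<tau>) then eps k i else 0)"
    by (rule sum.cong) (auto simp: senders_def)
  also have "\<dots> = input i t" unfolding input_def
    using Pre_subset[OF assms]
    by (intro sum.mono_neutral_left) (auto simp: senders_def intro!: eps_eq_0[OF _ assms])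
  finally show ?thesis .
qed

lemma tendsto_right:
  assumes "i \<in> {1..N}" "0 \<le> t"
  shows "(\<phi> i \<longlongrightarrow> phase_after i t) (at_right t)"
proof (cases "fires \<phi> i t")
  case True
  then show ?thesis using sol assms by (auto simp: solution_def fires_def phase_after_def)
next
  case False
  then have "(\<phi> i has_real_derivative 1) (at_right t)"
    using sol assms by (auto simp: solution_def)
  then have "(\<phi> i \<longlongrightarrow> \<phi> i t) (at_right t)"
    using DERIV_continuous continuous_within by blast
  then show ?thesis using False assms by (auto simp: fires_def phase_after_def)
qed

text \<open>One formula covers both cases: without senders the phase is left-continuous,
  \<open>input i t\<close> is 0 and the minimum is inactive because \<open>f\<close> is at most 1.
  Applying \<open>f\<close> removes the inverse from the jump rule.\<close>

lemma tendsto_left_jump: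
  assumes "i \<in> {1..N}" "0 < t"
  obtains l where "(\<phi> i \<longlongrightarrow> l) (at_left t)" "0 \<le> l" "l \<le> 1"
    "f (\<phi> i t) = min 1 (f l + input i t)"
proof -
  have range: "0 \<le> l \<and> l \<le> 1" if "(\<phi> i \<longlongrightarrow> l) (at_left t)" for l
  proof -
    have "eventually (\<lambda>s. s \<in> {0<..<t}) (at_left t)"
      using assms by (intro eventually_at_leftI[of 0]) auto
    then have "eventually (\<lambda>s. 0 \<le> \<phi> i s \<and> \<phi> i s \<le> 1) (at_left t)"
      by (rule eventually_mono) (use phase_range assms in auto)
    then show ?thesis
      using tendsto_lowerbound[OF that, of 0] tendsto_upperbound[OF that, of 1]
      by (auto simp: eventually_conj_iff)
  qed
  show ?thesis
  proof (cases "senders Pre \<tau> \<phi> i t = {}")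
    case True
    then have "(\<phi> i has_real_derivative 1) (at_left t)"
      using sol assms by (auto simp: solution_def)
    then have "(\<phi> i \<longlongrightarrow> \<phi> i t) (at_left t)"
      using DERIV_continuous continuous_within by blast
    moreover have "input i t = 0"
      using sum_senders_eq_input[OF assms(1), of t] True by simp
    ultimately show ?thesis
      using that[of "\<phi> i t"] phase_range[of i t] f_range[of "\<phi> i t"] assms by auto
  next
    case False
    then have "\<exists>l. (\<phi> i \<longlongrightarrow> l) (at_left t) \<and> \<phi> i t
        = the_inv_into {0..1} f (min 1 (f l + (\<Sum>k\<in>senders Pre \<tau> \<phi> i t. eps k i)))"
      using sol assms unfolding solution_def by blast
    then obtain l where l: "(\<phi> i \<longlongrightarrow> l) (at_left t)"
        "\<phi> i t = the_inv_into {0..1} f (min 1 (f l + input i t))"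
      unfolding sum_senders_eq_input[OF assms(1)] by blast
    have "min 1 (f l + input i t) \<in> f ` {0..1}"
      using range[OF l(1)] f_range[of l] input_nonneg[OF assms(1)]
      by (auto simp: rise_function_image[OF rise])
    then have "f (\<phi> i t) = min 1 (f l + input i t)"
      unfolding l(2) by (rule f_the_inv_into_f[OF f_inj])
    then show ?thesis using that l(1) range[OF l(1)] by blast
  qed
qed

section \<open>Firings do not accumulate\<close>

lemma eventually_right_not_fires:
  assumes "i \<in> {1..N}" "0 \<le> t"
  shows "eventually (\<lambda>s. \<not> fires \<phi> i s) (at_right t)"
proof -
  have "phase_after i t < 1"
    using phase_range[OF assms] by (auto simp: phase_after_def)
  with tendsto_right[OF assms] have "eventually (\<lambda>s. \<phi> i s < 1) (at_right t)"
    by (rule order_tendstoD)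
  then show ?thesis by (rule eventually_mono) (auto simp: fires_def)
qed

lemma eventually_left_not_fires:
  assumes i: "i \<in> {1..N}" and "0 < t"
  shows "eventually (\<lambda>s. \<not> fires \<phi> i s) (at_left t)"
proof -
  obtain l where l: "(\<phi> i \<longlongrightarrow> l) (at_left t)" "0 \<le> l" "l \<le> 1"
    using assms by (rule tendsto_left_jump)
  show ?thesis
  proof (cases "l = 1")
    case False
    then have "eventually (\<lambda>s. \<phi> i s < 1) (at_left t)"
      using l by (intro order_tendstoD) auto
    then show ?thesis by (rule eventually_mono) (auto simp: fires_def)
  next
    case True
    \<comment> \<open>Just after a firing the phase is near 0, which a left limit 1 excludes.\<close>
    then have "eventually (\<lambda>s. \<phi> i s > 1/2) (at_left t)"
      using l(1) by (intro order_tendstoD(1)) auto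
    then obtain c where c: "c < t" "\<And>s. c < s \<Longrightarrow> s < t \<Longrightarrow> \<phi> i s > 1/2"
      by (auto simp: eventually_at_left_field)
    have "\<not> fires \<phi> i s" if s: "c < s" "s < t" for s
    proof
      assume fires: "fires \<phi> i s"
      then have "(\<phi> i \<longlongrightarrow> 0) (at_right s)"
        using sol i by (auto simp: solution_def)
      then have "eventually (\<lambda>u. \<phi> i u < 1/2) (at_right s)"
        by (rule order_tendstoD) auto
      moreover have "eventually (\<lambda>u. u \<in> {s<..<t}) (at_right s)"
        using s by (intro eventually_at_rightI[of s t]) auto
      ultimately have "eventually (\<lambda>u. False) (at_right s)"
        by eventually_elim (use c(2) s in \<open>smt (verit) greaterThanLessThan_iff\<close>)
      then show False by simp
    qed
    then show ?thesis using c(1) by (auto simp: eventually_at_left_field)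
  qed
qed

text \<open>Neither side of any point carries accumulating firings, and an infinite subset of the
  compact \<open>{0..t}\<close> would have a limit point.\<close>

lemma finite_firings:
  assumes "i \<in> {1..N}"
  shows "finite {s. fires \<phi> i s \<and> s \<le> t}"
proof -
  have "\<not> x islimpt {s. fires \<phi> i s}" if "x \<in> {0..t}" for x
  proof -
    have "eventually (\<lambda>s. \<not> fires \<phi> i s) (at_left x)"
    proof (cases "x = 0")
      case True
      then show ?thesis
        by (auto simp: eventually_at_left_field fires_def intro: exI[of _ "-1"])
    qed (use that assms in \<open>auto intro: eventually_left_not_fires\<close>)
    moreover have "eventually (\<lambda>s. \<not> fires \<phi> i s) (at_right x)"
      using that assms by (auto intro: eventually_right_not_fires)
    ultimately show ?thesis by (simp add: islimpt_iff_eventually eventually_at_split)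
  qed
  then have "finite ({0..t} \<inter> {s. fires \<phi> i s})"
    by (intro finite_not_islimpt_in_compact) auto
  then show ?thesis by (rule finite_subset[rotated]) (auto simp: fires_def)
qed

lemma finite_events: "finite (events \<inter> {T..t})"
proof (rule finite_subset)
  show "events \<inter> {T..t} \<subseteq> (\<Union>k\<in>{1..N}. {s. fires \<phi> k s \<and> s \<le> t}
      \<union> (\<lambda>s. s + \<tau>) ` {s. fires \<phi> k s \<and> s \<le> t - \<tau>})"
    by (auto simp: events_def image_iff intro!: bexI exI[of _ "_ - \<tau>"])
qed (use finite_firings in auto)

section \<open>Motion between consecutive events and existence of all firing times\<close>

text \<open>Between events \<open>\<phi> i s - s\<close> has derivative 0 and is constant. The right
  limit at \<open>a\<close> fixes the constant, which gives the left limit at \<open>b\<close>; the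
  jump rule then gives the value at \<open>b\<close>.\<close>

lemma evolution:
  assumes i: "i \<in> {1..N}" and "0 \<le> a" "a < b" and no_events: "events \<inter> {a<..<b} = {}"
  shows "phase_after i a + (b - a) \<le> 1"
    and "f (\<phi> i b) = min 1 (f (phase_after i a + (b - a)) + input i b)"
proof -
  have deriv: "((\<lambda>s. \<phi> i s - s) has_real_derivative 0) (at s)" if s: "s \<in> {a<..<b}" for s
  proof -
    have "s \<notin> events" using no_events s by blast
    then have "\<not> fires \<phi> i s" "senders Pre \<tau> \<phi> i s = {}"
      using i Pre_subset[OF i] by (auto simp: events_def senders_def)
    then have "(\<phi> i has_real_derivative 1) (at_right s)" "(\<phi> i has_real_derivative 1) (at_left s)"
      using sol i s \<open>0 \<le> a\<close> by (auto simp: solution_def)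
    then have "(\<phi> i has_real_derivative 1) (at s)"
      by (auto simp: has_field_derivative_iff intro: filterlim_split_at)
    then show ?thesis by (auto intro!: derivative_eq_intros)
  qed
  define c where "c = \<phi> i ((a + b) / 2) - (a + b) / 2"
  have lin: "\<phi> i s = c + s" if "s \<in> {a<..<b}" for s
    using DERIV_isconst3[OF \<open>a < b\<close> that _ deriv, of "(a + b) / 2"] \<open>a < b\<close>
    by (auto simp: c_def algebra_simps)
  have "((\<lambda>s. c + s) \<longlongrightarrow> phase_after i a) (at_right a)"
  proof (rule Lim_transform_eventually[OF tendsto_right[OF i \<open>0 \<le> a\<close>]])
    show "eventually (\<lambda>s. \<phi> i s = c + s) (at_right a)"
      using lin \<open>a < b\<close> by (intro eventually_at_rightI[of a b]) auto
  qed
  moreover have "((\<lambda>s. c + s) \<longlongrightarrow> c + a) (at_right a)" by (intro tendsto_intros)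
  ultimately have ca: "c + a = phase_after i a"
    using tendsto_unique trivial_limit_at_right_real by blast
  have "0 < b" using \<open>0 \<le> a\<close> \<open>a < b\<close> by simp
  then obtain l where l: "(\<phi> i \<longlongrightarrow> l) (at_left b)" "l \<le> 1"
      "f (\<phi> i b) = min 1 (f l + input i b)"
    using tendsto_left_jump[OF i] by metis
  have "((\<lambda>s. c + s) \<longlongrightarrow> l) (at_left b)"
  proof (rule Lim_transform_eventually[OF l(1)])
    show "eventually (\<lambda>s. \<phi> i s = c + s) (at_left b)"
      using lin \<open>a < b\<close> by (intro eventually_at_leftI[of a b]) auto
  qed
  moreover have "((\<lambda>s. c + s) \<longlongrightarrow> c + b) (at_left b)" by (intro tendsto_intros)
  ultimately have "l = c + b"
    using tendsto_unique trivial_limit_at_left_real by blast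
  then have "l = phase_after i a + (b - a)" using ca by simp
  then show "phase_after i a + (b - a) \<le> 1"
    and "f (\<phi> i b) = min 1 (f (phase_after i a + (b - a)) + input i b)"
    using l by auto
qed

lemma phase_ge_free_phase:
  assumes "i \<in> {1..N}" "0 \<le> a" "a < b" "events \<inter> {a<..<b} = {}"
  shows "phase_after i a + (b - a) \<le> \<phi> i b"
proof -
  let ?x = "phase_after i a + (b - a)"
  have x: "0 \<le> ?x" "?x \<le> 1"
    using evolution(1)[OF assms] phase_after_range[of i a] assms by auto
  have "f ?x \<le> f (\<phi> i b)"
    using evolution(2)[OF assms] f_range[OF x] input_nonneg[of i b] assms by auto
  then show ?thesis using x phase_range[of i b] assms by (subst (asm) f_le_iff) auto
qed

text \<open>Without further resets the phase grows at least at unit rate, since spikes only advance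
  it, and would exceed 1 by time \<open>T + 2\<close>.\<close>

lemma firings_unbounded:
  assumes i: "i \<in> {1..N}"
  shows "\<exists>s. fires \<phi> i s \<and> t < s"
proof (rule ccontr)
  assume none: "\<nexists>s. fires \<phi> i s \<and> t < s"
  define T where "T = max t 0"
  have "s - T \<le> phase_after i s" if "T \<le> s" for s
    using that finite_events
  proof (induction rule: locally_finite_event_induct)
    case base
    show ?case using phase_after_range[of i T] i by (simp add: T_def)
  next
    case (step a b)
    have "0 \<le> a" "t < b" using step.hyps by (auto simp: T_def)
    then have "phase_after i b = \<phi> i b"
      using none step.hyps by (auto simp: phase_after_def fires_def)
    moreover have "phase_after i a + (b - a) \<le> \<phi> i b"
      using phase_ge_free_phase i step.hyps \<open>0 \<le> a\<close> by blast
    ultimately show ?case using step.IH[of a] step.hyps by simp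
  qed
  from this[of "T + 2"] show False
    using phase_after_range[of i "T + 2"] i by (simp add: T_def)
qed

lemma fires_firing_time:
  assumes "i \<in> {1..N}" "m \<ge> 1"
  shows "fires \<phi> i (firing_time \<phi> i m)"
proof -
  have "\<exists>!t. t \<in> {s. fires \<phi> i s} \<and> card {s \<in> {s. fires \<phi> i s}. s \<le> t} = m"
    by (rule discrete_unbounded_enumerate)
      (use assms finite_firings firings_unbounded in auto)
  from theI'[OF this] show ?thesis by (simp add: firing_time_def)
qed

section \<open>No oscillator fires twice within the delay\<close>

text \<open>If no oscillator fires twice within \<open>\<tau>\<close>, then the spikes received during a delay
  window have total strength at most \<open>etot\<close>. By concavity of \<open>f\<close> spikes are least effective
  when they come late, so in the \<open>f\<close>-scale they raise the free phase by at most their total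
  strength, and \<open>f \<tau> + etot < 1\<close> prevents firing. This yields an induction on time in steps
  of length \<open>\<tau>\<close>.\<close>
lemma no_firing_within_delay_step:
  assumes i: "i \<in> {1..N}" and s: "fires \<phi> i s" "s < s'" "s' \<le> s + \<tau>" and "s' - \<tau> \<le> c"
    and gap: "\<And>k u u'. \<lbrakk>k \<in> {1..N}; fires \<phi> k u; fires \<phi> k u'; u < u'; u' \<le> u + \<tau>\<rbrakk> \<Longrightarrow> c < u'"
  shows "\<not> fires \<phi> i s'"
proof -
  define S where "S t =
    (\<Sum>k\<in>{1..N}. if \<exists>u. s - \<tau> < u \<and> u \<le> t - \<tau> \<and> fires \<phi> k u then eps k i else 0)" for t
  have S_le: "S t \<le> etot" for t
    unfolding S_def sum_eps[OF i, symmetric] by (rule sum_mono) (use eps_nonneg i in auto)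
  have S_step: "S a + input i b \<le> S b" if "s \<le> a" "a < b" "b \<le> s'" for a b
    unfolding S_def input_def sum.distrib[symmetric]
  proof (rule sum_mono)
    fix k assume k: "k \<in> {1..N}"
    have "\<not> (s - \<tau> < u \<and> u \<le> a - \<tau> \<and> fires \<phi> k u)" if "fires \<phi> k (b - \<tau>)" for u
      using gap[OF k, of u "b - \<tau>"] that \<open>s \<le> a\<close> \<open>a < b\<close> \<open>b \<le> s'\<close> s \<open>s' - \<tau> \<le> c\<close> by fastforce
    moreover have "s - \<tau> < b - \<tau>" "a - \<tau> \<le> b - \<tau>" using that by auto
    ultimately show "(if \<exists>u. s - \<tau> < u \<and> u \<le> a - \<tau> \<and> fires \<phi> k u then eps k i else 0)
        + (if fires \<phi> k (b - \<tau>) then eps k i else 0)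
      \<le> (if \<exists>u. s - \<tau> < u \<and> u \<le> b - \<tau> \<and> fires \<phi> k u then eps k i else 0)"
      using eps_nonneg[OF k i] by (smt (verit, best))
  qed
  have "0 \<le> s" using s by (simp add: fires_def)
  have "t \<le> s' \<longrightarrow> t - s \<le> phase_after i t \<and> f (phase_after i t) \<le> f (t - s) + S t
      \<and> (s < t \<longrightarrow> \<not> fires \<phi> i t)" if "s \<le> t" for t
    using that finite_events
  proof (induction rule: locally_finite_event_induct)
    case base
    have "0 \<le> S s" unfolding S_def using eps_nonneg i by (intro sum_nonneg) auto
    then show ?case using s by (simp add: fires_def phase_after_def)
  next
    case (step a b)
    show ?case
    proof
      assume "b \<le> s'"
      have "0 \<le> a" using step.hyps \<open>0 \<le> s\<close> by simp
      have IH: "a - s \<le> phase_after i a" "f (phase_after i a) \<le> f (a - s) + S a"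
        using step.IH[of a] step.hyps \<open>b \<le> s'\<close> by auto
      let ?x = "phase_after i a + (b - a)"
      have x: "?x \<le> 1" "f (\<phi> i b) = min 1 (f ?x + input i b)"
        using evolution[OF i \<open>0 \<le> a\<close>] step.hyps by auto
      have "f ?x - f (phase_after i a) \<le> f (a - s + (b - a)) - f (a - s)"
        using IH step.hyps x(1) by (intro rise_function_increment_antimono[OF rise]) auto
      then have "f (\<phi> i b) \<le> f (b - s) + (S a + input i b)"
        using x(2) IH(2) by (simp add: algebra_simps)
      also have "S a + input i b \<le> S b"
        using S_step step.hyps \<open>b \<le> s'\<close> by simp
      finally have bound: "f (\<phi> i b) \<le> f (b - s) + S b" by simp
      have "f (b - s) \<le> f \<tau>"
        using step.hyps \<open>b \<le> s'\<close> s delay by (subst f_le_iff) auto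
      then have "f (\<phi> i b) < 1" using bound S_le[of b] weak by simp
      then have nf: "\<phi> i b \<noteq> 1" using rise by (auto simp: rise_function_def)
      have "?x \<le> \<phi> i b"
        using phase_ge_free_phase[OF i \<open>0 \<le> a\<close>] step.hyps by blast
      then have "b - s \<le> \<phi> i b" using IH(1) by simp
      then show "b - s \<le> phase_after i b \<and> f (phase_after i b) \<le> f (b - s) + S b
          \<and> (s < b \<longrightarrow> \<not> fires \<phi> i b)"
        using nf bound by (auto simp: phase_after_def fires_def)
    qed
  qed
  then show ?thesis using s by auto
qed

lemma no_firing_within_delay:
  assumes "i \<in> {1..N}" "fires \<phi> i s" "s < s'" "s' \<le> s + \<tau>"
  shows "\<not> fires \<phi> i s'"
proof -
  have gap: "real n * \<tau> < u'"
    if "k \<in> {1..N}" "fires \<phi> k u" "fires \<phi> k u'" "u < u'" "u' \<le> u + \<tau>" for n k u u'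
    using that
  proof (induction n arbitrary: k u u')
    case 0
    then show ?case by (simp add: fires_def)
  next
    case (Suc n)
    show ?case
    proof (rule ccontr)
      assume "\<not> real (Suc n) * \<tau> < u'"
      then have "u' - \<tau> \<le> real n * \<tau>" by (simp add: algebra_simps)
      with Suc.prems(1,2,4,5) have "\<not> fires \<phi> k u'"
        using Suc.IH by (rule no_firing_within_delay_step)
      then show False using Suc.prems(3) by blast
    qed
  qed
  obtain n :: nat where "s' < real n * \<tau>"
    using reals_Archimedean3[OF delay(1)] by blast
  then show ?thesis using gap[of i s s' n] assms by fastforce
qed

lemma simultaneous_firing_imp_synchronized:
  assumes ij: "i \<in> {1..N}" "j \<in> {1..N}"
    and sym: "eps i j = eps j i" "\<forall>k\<in>{1..N} - {i, j}. eps k i = eps k j"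
    and T: "fires \<phi> i T" "fires \<phi> j T" and "T \<le> t"
  shows "\<phi> i t = \<phi> j t"
  using \<open>T \<le> t\<close> finite_events
proof (induction rule: locally_finite_event_induct)
  case base
  then show ?case using T by (simp add: fires_def)
next
  case (step a b)
  have "0 \<le> a" using step.hyps T by (simp add: fires_def)
  have same: "fires \<phi> i (b - \<tau>) \<longleftrightarrow> fires \<phi> j (b - \<tau>)"
  proof (cases "T \<le> b - \<tau>")
    case True
    show ?thesis
    proof (cases "b - \<tau> \<le> a")
      case True
      then show ?thesis using step.IH[OF \<open>T \<le> b - \<tau>\<close>] by (simp add: fires_def)
    next
      case False
      then have "b - \<tau> \<notin> events" using step.hyps delay by auto
      then show ?thesis using ij by (auto simp: events_def)
    qed
  next
    case False
    then show ?thesis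
      using no_firing_within_delay[of _ "b - \<tau>" T] T ij step.hyps by auto
  qed
  have "input i b = input j b"
  proof (cases "i = j")
    case False
    have split: "input l b = (if fires \<phi> i (b - \<tau>) then eps i l else 0)
        + ((if fires \<phi> j (b - \<tau>) then eps j l else 0)
        + (\<Sum>k\<in>{1..N} - {i} - {j}. if fires \<phi> k (b - \<tau>) then eps k l else 0))" for l
      unfolding input_def using ij False
      by (subst sum.remove[of _ i], simp, simp, subst sum.remove[of _ j]) auto
    have "(\<Sum>k\<in>{1..N} - {i} - {j}. if fires \<phi> k (b - \<tau>) then eps k i else 0)
        = (\<Sum>k\<in>{1..N} - {i} - {j}. if fires \<phi> k (b - \<tau>) then eps k j else 0)"
      using sym(2) by (intro sum.cong) auto
    then show ?thesis
      using split[of i] split[of j] same sym(1) ij by (simp add: eps_self)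
  qed simp
  moreover have "phase_after i a = phase_after j a"
    using step.IH[of a] step.hyps by (simp add: phase_after_def)
  ultimately have "f (\<phi> i b) = f (\<phi> j b)"
    using evolution(2)[OF _ \<open>0 \<le> a\<close>] step.hyps ij by simp
  then show ?case
    using inj_onD[OF f_inj] phase_range ij \<open>0 \<le> a\<close> step.hyps by auto
qed

end

theorem mainTheorem4:
  fixes N :: nat and Pre :: "nat \<Rightarrow> nat set" and eps :: "nat \<Rightarrow> nat \<Rightarrow> real"
    and etot \<tau> :: real and f :: "real \<Rightarrow> real" and \<phi> :: "nat \<Rightarrow> real \<Rightarrow> real"
    and i j m\<^sub>i m\<^sub>j :: nat
  assumes "rise_function f"
    and "pulse_network N Pre eps etot"
    and "0 < \<tau>" and "\<tau> < 1"
    and "0 < etot" and "etot < 1"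
    and "f \<tau> + etot < 1"
    and "i \<in> {1..N}" and "j \<in> {1..N}" and "i \<noteq> j"
    and "eps i j = eps j i"
    and "\<forall>k\<in>{1..N} - {i, j}. eps k i = eps k j"
    and "solution N Pre eps \<tau> f \<phi>"
    and "m\<^sub>i \<ge> 1" and "m\<^sub>j \<ge> 1"
    and "firing_time \<phi> i m\<^sub>i = firing_time \<phi> j m\<^sub>j"
  shows "\<forall>t \<ge> firing_time \<phi> i m\<^sub>i. \<phi> i t = \<phi> j t"
proof -
  interpret oscillator_network N Pre eps etot \<tau> f \<phi>
    using assms by unfold_locales
  show ?thesis
    using simultaneous_firing_imp_synchronized[of i j "firing_time \<phi> i m\<^sub>i"]
      fires_firing_time[of i m\<^sub>i] fires_firing_time[of j m\<^sub>j] assms by auto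
qed

end
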